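(* Let $2 \le k \le r \le n$ be integers. Then every ordered $n$-vertex $r$-graph $H$ is the union of pairwise edge-disjoint ordered $r$-graphs $H_i$, $0 \le i \le \lfloor \log_2 n\rfloor$ (subgraphs of $H$ with the same vertex ordering), such that for each $i$ the $r$-graph $H_i$ is a union of at most $$\frac{1}{(k-1)!}\left(\sum_{j=k}^{r}\binom{2k-2}{j}\right) 2^{i(k-1)}$$ interval $k$-partite $r$-graphs with parts of size at most $\lceil n/2^i\rceil$.
   Context: An $r$-graph is a finite hypergraph all of whose edges have size $r$; hypergraphs are identified with their edge sets. An ordered $r$-graph is an $r$-graph together with a linear ordering of its vertex set $V$. An interval in $V$ is a set of consecutive elements in the ordering. For $A,B\subset V$, $A<B$ means $a<b$ for all $a\in A$, $b\in B$. An ordered $r$-graph $H$ is interval $k$-partite if for some $\ell\ge k$ there are intervals $I_1<I_2<\cdots<I_\ell$ of the vertex set such that every edge of $H$ is contained in $I_1\cup\dots\cup I_\ell$ and has nonempty intersection with $I_j$ for each $1\le j\le \ell$. The intervals $I_1,\dots,I_\ell$ are called the parts. Saying that an interval $k$-partite $r$-graph has parts of size at most $s$ means that such intervals can be chosen with $|I_j|\le s$ for all $j$. *)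

theory Defs
  imports Complex_Main "HOL-Library.Disjoint_Sets"
begin

text \<open>
  The vertex set of an ordered \<open>r\<close>-graph is a finite subset \<open>V\<close> of a linearly ordered type,
  ordered by the order of that type; a hypergraph is its set of edges.
\<close>

definition ordered_rgraph :: "nat \<Rightarrow> 'a::linorder set \<Rightarrow> 'a set set \<Rightarrow> bool" where
  "ordered_rgraph r V H \<longleftrightarrow> finite V \<and> (\<forall>e\<in>H. e \<subseteq> V \<and> card e = r)"

text \<open>Consecutive means consecutive within \<open>V\<close>, not within the ambient type.\<close>

definition interval_in :: "'a::linorder set \<Rightarrow> 'a set \<Rightarrow> bool" where
  "interval_in V I \<longleftrightarrow> I \<subseteq> V \<and> (\<forall>x\<in>I. \<forall>y\<in>I. \<forall>z\<in>V. x \<le> z \<and> z \<le> y \<longrightarrow> z \<in> I)"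

definition set_before :: "'a::linorder set \<Rightarrow> 'a set \<Rightarrow> bool" where
  "set_before A B \<longleftrightarrow> (\<forall>a\<in>A. \<forall>b\<in>B. a < b)"

definition interval_parts ::
    "'a::linorder set \<Rightarrow> 'a set set \<Rightarrow> nat \<Rightarrow> (nat \<Rightarrow> 'a set) \<Rightarrow> bool" where
  "interval_parts V G l I \<longleftrightarrow>
     (\<forall>j\<in>{1..l}. interval_in V (I j)) \<and>
     (\<forall>i\<in>{1..l}. \<forall>j\<in>{1..l}. i < j \<longrightarrow> set_before (I i) (I j)) \<and>
     (\<forall>e\<in>G. e \<subseteq> (\<Union>j\<in>{1..l}. I j) \<and> (\<forall>j\<in>{1..l}. e \<inter> I j \<noteq> {}))"

definition interval_partite_parts_le ::
    "nat \<Rightarrow> nat \<Rightarrow> int \<Rightarrow> 'a::linorder set \<Rightarrow> 'a set set \<Rightarrow> bool" where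
  "interval_partite_parts_le r k s V G \<longleftrightarrow>
     ordered_rgraph r V G \<and>
     (\<exists>l\<ge>k. \<exists>I. interval_parts V G l I \<and> (\<forall>j\<in>{1..l}. int (card (I j)) \<le> s))"

end

theory Submission
  imports Defs
begin

text \<open>
  Cut \<open>V\<close> into \<open>2 ^ i\<close> nested dyadic blocks of size at most \<open>\<lceil>n / 2 ^ i\<rceil>\<close> for every \<open>i\<close>. Put an edge
  into \<open>H\<^sub>i\<close> if \<open>i + 1\<close> is the first level at which it meets at least \<open>k\<close> blocks, and split \<open>H\<^sub>i\<close>
  according to the set \<open>S\<close> of blocks of level \<open>i + 1\<close> that an edge meets. As the edge meets at most
  \<open>k - 1\<close> blocks of level \<open>i\<close>, the set \<open>S\<close> consists of \<open>j\<close> out of \<open>2 k - 2\<close> halves of \<open>k - 1\<close>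
  blocks, with \<open>k \<le> j \<le> r\<close>, and there are at most \<open>2 ^ (i (k - 1)) / (k - 1)!\<close> choices of these
  \<open>k - 1\<close> blocks. If there are fewer than \<open>k - 1\<close> blocks of level \<open>i\<close>, all sets \<open>S\<close> are counted
  instead, using \<open>K! \<le> ((K + 1) / 2) ^ K\<close>.
\<close>

section \<open>Counting the sets of blocks that an edge can meet\<close>

lemma fact_le_power_half:
  fixes K m :: nat
  assumes "K + 1 \<le> 2 * m"
  shows "fact K \<le> m ^ K"
proof -
  \<comment> \<open>Squaring the factorial pairs each factor \<open>i\<close> with
    \<open>K + 1 - i\<close>. The two sum to at most \<open>2 * m\<close>, so their product is at
    most \<open>m\<^sup>2\<close>.\<close>
  have "(fact K :: nat) = (\<Prod>i=1..K. K + 1 - i)"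
    unfolding fact_prod of_nat_id by (subst prod.atLeastAtMost_rev) simp
  then have "(fact K :: nat)\<^sup>2 = (\<Prod>i=1..K. i * (K + 1 - i))"
    by (simp add: power2_eq_square fact_prod prod.distrib)
  also have "\<dots> \<le> (\<Prod>i=1..K. m\<^sup>2)"
  proof (rule prod_mono, safe)
    fix i assume i: "i \<in> {1..K}"
    have "int i * (2 * int m - int i) = (int m)\<^sup>2 - (int m - int i)\<^sup>2"
      by (simp add: power2_eq_square algebra_simps)
    also have "\<dots> \<le> (int m)\<^sup>2" by simp
    finally have "int (i * (2 * m - i)) \<le> int (m\<^sup>2)"
      using i assms by (simp add: of_nat_diff)
    then have "i * (2 * m - i) \<le> m\<^sup>2" by linarith
    moreover have "i * (K + 1 - i) \<le> i * (2 * m - i)"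
      using assms by (intro mult_left_mono) auto
    ultimately show "i * (K + 1 - i) \<le> m\<^sup>2" by linarith
  qed
  also have "\<dots> = (m ^ K)\<^sup>2" by (simp flip: power_mult add: mult.commute)
  finally show ?thesis by (rule power2_le_imp_le) simp
qed

lemma card_subsets_of_sizes:
  assumes "finite A" "finite J"
  shows "card {S. S \<subseteq> A \<and> card S \<in> J} = (\<Sum>j\<in>J. card A choose j)"
proof -
  have "{S. S \<subseteq> A \<and> card S \<in> J} = (\<Union>j\<in>J. {S. S \<subseteq> A \<and> card S = j})" by auto
  moreover have "card (\<Union>j\<in>J. {S. S \<subseteq> A \<and> card S = j}) = (\<Sum>j\<in>J. card {S. S \<subseteq> A \<and> card S = j})"
    using assms by (intro card_UN_disjoint) auto
  ultimately show ?thesis using assms by (simp add: n_subsets)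
qed

text \<open>Here \<open>m\<close> is the number of blocks of one level, \<open>q\<close> runs
  through their halves, and \<open>q div 2\<close> is the block containing \<open>q\<close>. If
  \<open>K \<le> m\<close>, the blocks touched by \<open>S\<close> extend to a set \<open>T\<close>
  of exactly \<open>K\<close> blocks, and \<open>S\<close> is chosen among the halves of
  \<open>T\<close>.\<close>

lemma card_subsets_few_halves:
  fixes m K r :: nat
  shows "real (card {S. S \<subseteq> {..<2 * m} \<and> card S \<in> {K + 1..r} \<and> card ((\<lambda>q. q div 2) ` S) \<le> K})
    \<le> real m ^ K / fact K * (\<Sum>j=K + 1..r. real ((2 * K) choose j))"
    (is "real (card ?A) \<le> _")
proof -
  define s where "s = (\<Sum>j=K + 1..r. (2 * K) choose j)"
  have "card ?A * fact K \<le> m ^ K * s"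
  proof (cases "K \<le> m")
    case True
    define TT where "TT = {T. T \<subseteq> {..<m} \<and> card T = K}"
    \<comment> \<open>The halves \<open>2 * t\<close> and \<open>2 * t + 1\<close> of the blocks
      \<open>t\<close> in \<open>T\<close>. There are \<open>2 * K\<close> of them if
      \<open>card T = K\<close>, whence the upper index in the binomials.\<close>
    define ch where "ch T = {q. q div 2 \<in> T}" for T :: "nat set"
    have ch: "finite (ch T)" "card (ch T) = 2 * card T" if "finite T" for T
    proof -
      have eq: "ch T = (\<lambda>(t, b). 2 * t + b) ` (T \<times> {0, 1})"
      proof
        show "ch T \<subseteq> (\<lambda>(t, b). 2 * t + b) ` (T \<times> {0, 1})"
        proof
          fix q assume "q \<in> ch T"
          then have "(q div 2, q mod 2) \<in> T \<times> {0, 1}" by (auto simp: ch_def)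
          moreover have "q = (\<lambda>(t, b). 2 * t + b) (q div 2, q mod 2)" by simp
          ultimately show "q \<in> (\<lambda>(t, b). 2 * t + b) ` (T \<times> {0, 1})"
            by (rule image_eqI[rotated])
        qed
      qed (auto simp: ch_def)
      have "inj_on (\<lambda>(t, b). 2 * t + b :: nat) (T \<times> {0, 1})"
        by (auto simp: inj_on_def; presburger)
      then show "card (ch T) = 2 * card T"
        unfolding eq by (simp add: card_image card_cartesian_product)
      show "finite (ch T)" unfolding eq using that by simp
    qed
    have finT: "finite T" "card T = K" if "T \<in> TT" for T
      using that finite_subset[of T "{..<m}"] by (auto simp: TT_def)
    have finTT: "finite TT" unfolding TT_def by simp
    have "?A \<subseteq> (\<Union>T\<in>TT. {S. S \<subseteq> ch T \<and> card S \<in> {K + 1..r}})"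
    proof
      fix S assume S: "S \<in> ?A"
      let ?P = "(\<lambda>q. q div 2) ` S"
      have "?P \<subseteq> {..<m}" using S by auto
      then obtain T where "?P \<subseteq> T" "T \<subseteq> {..<m}" "card T = K"
        using S True exists_subset_between[of ?P K "{..<m}"] by auto
      then show "S \<in> (\<Union>T\<in>TT. {S. S \<subseteq> ch T \<and> card S \<in> {K + 1..r}})"
        using S by (auto simp: TT_def ch_def)
    qed
    moreover have "finite (\<Union>T\<in>TT. {S. S \<subseteq> ch T \<and> card S \<in> {K + 1..r}})"
      using finTT ch(1) finT by auto
    ultimately have "card ?A \<le> card (\<Union>T\<in>TT. {S. S \<subseteq> ch T \<and> card S \<in> {K + 1..r}})"
      by (rule card_mono[rotated])
    also have "\<dots> \<le> (\<Sum>T\<in>TT. card {S. S \<subseteq> ch T \<and> card S \<in> {K + 1..r}})"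
      by (rule card_UN_le[OF finTT])
    also have "\<dots> = (\<Sum>T\<in>TT. s)"
      using ch finT by (intro sum.cong) (simp_all only: card_subsets_of_sizes s_def finite_atLeastAtMost)
    also have "\<dots> = (m choose K) * s" by (simp add: TT_def n_subsets)
    finally have "card ?A * fact K \<le> ((m choose K) * fact K) * s"
      by (simp add: mult.commute mult.left_commute)
    also have "\<dots> \<le> m ^ K * s" by (intro mult_right_mono binomial_fact_pow) simp
    finally show ?thesis .
  next
    \<comment> \<open>No \<open>T\<close> with \<open>K\<close> elements exists, so all sets of
      halves of the right sizes are counted. Since \<open>2 * m \<le> 2 * K\<close>, each binomial
      is small enough, and \<open>fact K \<le> m ^ K\<close> absorbs the factorial.\<close>
    case False
    have fin: "finite {S. S \<subseteq> {..<2 * m} \<and> card S \<in> {K + 1..r}}" by simp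
    have "card ?A \<le> card {S. S \<subseteq> {..<2 * m} \<and> card S \<in> {K + 1..r}}"
      by (rule card_mono[OF fin]) auto
    also have "\<dots> = (\<Sum>j=K + 1..r. (2 * m) choose j)"
      by (simp only: card_subsets_of_sizes finite_atLeastAtMost finite_lessThan card_lessThan)
    finally have A: "card ?A \<le> (\<Sum>j=K + 1..r. (2 * m) choose j)" .
    show ?thesis
    proof (cases "K + 1 \<le> 2 * m")
      case True
      have "(\<Sum>j=K + 1..r. (2 * m) choose j) \<le> s"
        unfolding s_def using False by (intro sum_mono binomial_right_mono) auto
      then show ?thesis
        using A mult_mono[of "card ?A" s "fact K" "m ^ K"] fact_le_power_half[OF True]
        by (simp add: mult.commute)
    next
      \<comment> \<open>Now there are at most \<open>K\<close> halves in all, so no set has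
        \<open>K + 1\<close> elements.\<close>
      case False
      then have "(\<Sum>j=K + 1..r. (2 * m) choose j) = 0" by (intro sum.neutral) auto
      then have "card ?A = 0" using A by linarith
      then show ?thesis by (simp only: mult_0 zero_le)
    qed
  qed
  then have "real (card ?A * fact K) \<le> real (m ^ K * s)" by (simp only: of_nat_le_iff)
  then have "real (card ?A) * fact K \<le> real m ^ K * real s"
    by (simp only: of_nat_mult of_nat_power of_nat_fact)
  then show ?thesis by (simp add: s_def field_simps)
qed

section \<open>Dyadic blocks of the vertex set\<close>

definition rank_in :: "'a::linorder set \<Rightarrow> 'a \<Rightarrow> nat" where
  "rank_in V x = card {v \<in> V. v < x}"

text \<open>The ranks start at 0 and lie in a real interval of length \<open>card V\<close>, which
  is cut into \<open>2 ^ i\<close> equal pieces; the value is the index of the piece. Rounding down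
  in a single division makes the levels nested exactly, even if \<open>card V\<close> is not a power
  of two. Blocks may be empty.\<close>

definition block :: "'a::linorder set \<Rightarrow> nat \<Rightarrow> 'a \<Rightarrow> nat" where
  "block V i x = rank_in V x * 2 ^ i div card V"

lemma rank_in_less:
  assumes "finite V" "x \<in> V" "x < y"
  shows "rank_in V x < rank_in V y"
  unfolding rank_in_def using assms by (intro psubset_card_mono) auto

lemma rank_in_inj_on: "finite V \<Longrightarrow> inj_on (rank_in V) V"
  by (metis inj_onI less_irrefl linorder_neqE rank_in_less)

lemma rank_in_less_card: "finite V \<Longrightarrow> x \<in> V \<Longrightarrow> rank_in V x < card V"
  unfolding rank_in_def by (intro psubset_card_mono) auto

lemma rank_in_mono: "finite V \<Longrightarrow> x \<le> y \<Longrightarrow> rank_in V x \<le> rank_in V y"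
  unfolding rank_in_def by (intro card_mono) auto

lemma block_mono: "finite V \<Longrightarrow> x \<le> y \<Longrightarrow> block V i x \<le> block V i y"
  unfolding block_def by (intro div_le_mono mult_right_mono rank_in_mono) auto

lemma block_less: "finite V \<Longrightarrow> x \<in> V \<Longrightarrow> block V i x < 2 ^ i"
  unfolding block_def using rank_in_less_card[of V x]
  by (simp add: div_less_iff_less_mult mult.commute)

lemma block_Suc_div_2: "block V (Suc i) x div 2 = block V i x"
proof -
  have "block V (Suc i) x div 2 = (rank_in V x * 2 ^ i * 2) div (card V * 2)"
    unfolding block_def by (simp add: div_mult2_eq[symmetric] mult.commute mult.left_commute)
  then show ?thesis by (simp add: block_def)
qed

text \<open>Distinct ranks, multiplied by \<open>2 ^ i\<close>, differ by at least
  \<open>card V\<close>, so their quotients differ.\<close>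

lemma block_inj_on:
  assumes "finite V" "card V \<le> 2 ^ i"
  shows "inj_on (block V i) V"
proof -
  have "block V i x < block V i y" if "x \<in> V" "y \<in> V" "x < y" for x y
  proof -
    have c: "card V > 0" using that assms by (auto simp: card_gt_0_iff)
    have "(rank_in V x + 1) * 2 ^ i \<le> rank_in V y * 2 ^ i"
      using rank_in_less[OF assms(1) that(1,3)] by (intro mult_right_mono) auto
    then have "rank_in V x * 2 ^ i + card V \<le> rank_in V y * 2 ^ i"
      using assms(2) by simp
    then have "(rank_in V x * 2 ^ i + card V) div card V \<le> block V i y"
      unfolding block_def by (rule div_le_mono)
    then show ?thesis using c by (simp add: block_def)
  qed
  then show ?thesis by (metis inj_onI less_irrefl linorder_neqE)
qed

lemma interval_in_block: "finite V \<Longrightarrow> interval_in V {x \<in> V. block V i x = q}"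
  unfolding interval_in_def by (auto intro!: antisym) (metis block_mono)+

lemma set_before_block:
  "finite V \<Longrightarrow> p < q \<Longrightarrow> set_before {x \<in> V. block V i x = p} {x \<in> V. block V i x = q}"
  unfolding set_before_def by (auto dest: block_mono simp flip: not_le)

text \<open>The ranks in a block lie in a half-open real interval of length
  \<open>card V / 2 ^ i\<close>, so they fit into a window of that length, rounded up, starting at
  the least of them.\<close>

lemma card_block_le:
  assumes fin: "finite V"
  shows "int (card {x \<in> V. block V i x = q}) \<le> \<lceil>real (card V) / 2 ^ i\<rceil>"
proof (cases "{x \<in> V. block V i x = q} = {}")
  case False
  define B where "B = rank_in V ` {x \<in> V. block V i x = q}"
  define c where "c = nat \<lceil>real (card V) / 2 ^ i\<rceil>"
  have B: "finite B" "B \<noteq> {}" using fin False by (auto simp: B_def)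
  have n: "card V > 0" using fin False by (auto simp: card_gt_0_iff)
  have "b < Min B + c" if "b \<in> B" for b
  proof -
    have "Min B \<in> B" using B by simp
    then have "b * 2 ^ i div card V = q" "Min B * 2 ^ i div card V = q"
      using that by (auto simp: B_def block_def)
    then have "b * 2 ^ i < (q + 1) * card V" "q * card V \<le> Min B * 2 ^ i"
      using n div_less_iff_less_mult[of "card V" "b * 2 ^ i" "q + 1"]
        less_eq_div_iff_mult_less_eq[of "card V" q "Min B * 2 ^ i"] by auto
    then have "b * 2 ^ i < Min B * 2 ^ i + card V" by simp
    then have "real (b * 2 ^ i) < real (Min B * 2 ^ i + card V)" by (simp only: of_nat_less_iff)
    then have "real b < real (Min B) + real (card V) / 2 ^ i"
      by (simp add: field_simps)
    also have "\<dots> \<le> real (Min B + c)"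
      unfolding c_def by (simp add: of_nat_ceiling)
    finally show ?thesis by linarith
  qed
  then have "B \<subseteq> {Min B..<Min B + c}" using B by auto
  then have "card B \<le> c" using card_mono[of "{Min B..<Min B + c}" B] by simp
  moreover have "card B = card {x \<in> V. block V i x = q}"
    unfolding B_def using rank_in_inj_on[OF fin] by (intro card_image) (auto simp: inj_on_def)
  \<comment> \<open>The ceiling is nonnegative, so \<open>nat\<close> in the definition of
    \<open>c\<close> does not change it.\<close>
  moreover have "int c = \<lceil>real (card V) / 2 ^ i\<rceil>"
    unfolding c_def by (simp add: less_le_trans[of "-1" 0])
  ultimately show ?thesis by linarith
next
  case True
  then have "card {x \<in> V. block V i x = q} = 0" by (simp only: card.empty)
  then show ?thesis by (simp add: less_le_trans[of "-1" 0])
qed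

text \<open>The parts are the blocks with index in \<open>S\<close>, in increasing order. Their
  number \<open>card S\<close> may exceed \<open>k\<close>, which the definition permits.\<close>

lemma interval_partite_block_image:
  assumes G: "ordered_rgraph r V G" "\<And>e. e \<in> G \<Longrightarrow> block V i ` e = S"
    and S: "finite S" "k \<le> card S"
    and s: "\<lceil>real (card V) / 2 ^ i\<rceil> \<le> s"
  shows "interval_partite_parts_le r k s V G"
proof -
  define xs where "xs = sorted_list_of_set S"
  define I where "I j = {x \<in> V. block V i x = xs ! (j - 1)}" for j
  have fin: "finite V" and GV: "\<And>e. e \<in> G \<Longrightarrow> e \<subseteq> V" using G(1) by (auto simp: ordered_rgraph_def)
  have xs: "set xs = S" "length xs = card S" "sorted_wrt (<) xs"
    using S by (simp_all add: xs_def)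
  have nth: "xs ! (a - 1) < xs ! (b - 1)" if "a \<in> {1..card S}" "b \<in> {1..card S}" "a < b" for a b
    using that xs(2) by (intro sorted_wrt_nth_less[OF xs(3)]) auto
  have idx: "\<exists>j\<in>{1..card S}. xs ! (j - 1) = q" if "q \<in> S" for q
  proof -
    have "q \<in> set xs" using that xs(1) by simp
    then obtain a where "a < length xs" "xs ! a = q" by (auto simp only: in_set_conv_nth)
    then have "Suc a \<in> {1..card S}" "xs ! (Suc a - 1) = q" using xs(2) by simp_all
    then show ?thesis by blast
  qed
  have mem: "xs ! (j - 1) \<in> S" if "j \<in> {1..card S}" for j
    using that nth_mem[of "j - 1" xs] unfolding xs(1,2) by auto
  have "interval_parts V G (card S) I"
    unfolding interval_parts_def
  proof (intro conjI ballI impI)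
    fix e assume e: "e \<in> G"
    show "e \<subseteq> (\<Union>j\<in>{1..card S}. I j)"
    proof
      fix x assume x: "x \<in> e"
      then have "block V i x \<in> S" using G(2)[OF e] by auto
      then show "x \<in> (\<Union>j\<in>{1..card S}. I j)" using idx x GV[OF e] by (fastforce simp: I_def)
    qed
    fix j assume "j \<in> {1..card S}"
    then have "xs ! (j - 1) \<in> block V i ` e" using mem G(2)[OF e] by simp
    then show "e \<inter> I j \<noteq> {}" using GV[OF e] by (auto simp: I_def)
  qed (use fin nth in \<open>auto simp: I_def intro: interval_in_block set_before_block\<close>)
  moreover have "int (card (I j)) \<le> s" for j
    unfolding I_def using card_block_le[OF fin] s order_trans by blast
  ultimately show ?thesis
    unfolding interval_partite_parts_le_def using G(1) S(2) by blast
qed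

section \<open>Decomposition of the edge set by levels\<close>

theorem theorem1p1:
  fixes k r n :: nat and V :: "'a::linorder set" and H :: "'a set set"
  assumes "2 \<le> k" and "k \<le> r" and "r \<le> n"
    and "ordered_rgraph r V H" and "card V = n"
  shows "\<exists>Hs :: nat \<Rightarrow> 'a set set.
    H = (\<Union>i\<in>{0..nat \<lfloor>log 2 (real n)\<rfloor>}. Hs i) \<and>
    disjoint_family_on Hs {0..nat \<lfloor>log 2 (real n)\<rfloor>} \<and>
    (\<forall>i\<in>{0..nat \<lfloor>log 2 (real n)\<rfloor>}.
       \<exists>F :: 'a set set set.
         finite F \<and> Hs i = \<Union>F \<and>
         real (card F) \<le> 1 / fact (k - 1) * (\<Sum>j=k..r. real ((2 * k - 2) choose j)) * 2 ^ (i * (k - 1)) \<and>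
         (\<forall>G\<in>F. interval_partite_parts_le r k \<lceil>real n / 2 ^ i\<rceil> V G))"
proof -
  define L where "L = nat \<lfloor>log 2 (real n)\<rfloor>"
  define hit where "hit i e = card (block V i ` e)" for i e
  \<comment> \<open>The shift by \<open>Suc\<close> makes \<open>lev e\<close> the last level before
    the edge first meets \<open>k\<close> blocks; the least value exists by \<open>top\<close>
    below.\<close>
  define lev where "lev e = (LEAST i. k \<le> hit (Suc i) e)" for e
  define Hs where "Hs i = {e \<in> H. lev e = i}" for i
  have fin: "finite V" and HV: "\<And>e. e \<in> H \<Longrightarrow> e \<subseteq> V" and Hr: "\<And>e. e \<in> H \<Longrightarrow> card e = r"
    using assms by (auto simp: ordered_rgraph_def)
  have finE: "finite e" if "e \<in> H" for e using HV[OF that] fin finite_subset by blast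
  \<comment> \<open>Hence at level \<open>Suc L\<close> every block has at most one vertex and an
    edge meets \<open>r \<ge> k\<close> blocks, so the levels up to \<open>L\<close>
    suffice.\<close>
  have nL: "n \<le> 2 ^ Suc L"
  proof -
    have "n > 0" using assms by simp
    then have "log 2 (real n) < real (Suc L)" unfolding L_def by linarith
    then have "real n < 2 powr real (Suc L)" using \<open>n > 0\<close> by (simp add: log_less_iff)
    then have "real n < real (2 ^ Suc L)" by (simp only: powr_realpow of_nat_power of_nat_numeral zero_less_numeral)
    then show ?thesis by linarith
  qed
  have top: "k \<le> hit (Suc L) e" if "e \<in> H" for e
  proof -
    have "inj_on (block V (Suc L)) e"
      using block_inj_on[OF fin, of "Suc L"] nL assms(5) HV[OF that] inj_on_subset by blast
    then show ?thesis using Hr[OF that] assms(2) by (simp add: hit_def card_image)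
  qed
  have levL: "lev e \<le> L" if "e \<in> H" for e
    unfolding lev_def using top[OF that] by (rule Least_le)
  have lev1: "k \<le> hit (Suc (lev e)) e" if "e \<in> H" for e
    unfolding lev_def using top[OF that] by (rule LeastI)
  have lev0: "hit (lev e) e \<le> k - 1" if "e \<in> H" for e
  proof (cases "lev e")
    \<comment> \<open>Minimality says nothing here, but level 0 has a single block and
      \<open>k \<ge> 2\<close>.\<close>
    case 0
    have "block V 0 ` e \<subseteq> {0}" using block_less[OF fin, of _ 0] HV[OF that] by force
    then have "hit 0 e \<le> 1" unfolding hit_def using card_mono[of "{0}" "block V 0 ` e"] by simp
    then show ?thesis using 0 assms(1) by simp
  next
    case (Suc i)
    then have "\<not> k \<le> hit (Suc i) e" unfolding lev_def by (intro not_less_Least) simp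
    then show ?thesis using Suc by simp
  qed
  have "H = (\<Union>i\<in>{0..L}. Hs i)" using levL by (auto simp: Hs_def)
  moreover have "disjoint_family_on Hs {0..L}" by (auto simp: disjoint_family_on_def Hs_def)
  moreover have "\<exists>F. finite F \<and> Hs i = \<Union>F \<and>
      real (card F) \<le> 1 / fact (k - 1) * (\<Sum>j=k..r. real ((2 * k - 2) choose j)) * 2 ^ (i * (k - 1)) \<and>
      (\<forall>G\<in>F. interval_partite_parts_le r k \<lceil>real n / 2 ^ i\<rceil> V G)" for i
  proof -
    define A where "A = {S. S \<subseteq> {..<2 * 2 ^ i :: nat} \<and> card S \<in> {(k - 1) + 1..r}
      \<and> card ((\<lambda>q. q div 2) ` S) \<le> k - 1}"
    define Gs where "Gs S = {e \<in> Hs i. block V (Suc i) ` e = S}" for S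
    have finA: "finite A" unfolding A_def by simp
    have "block V (Suc i) ` e \<in> A" if e: "e \<in> Hs i" for e
    proof -
      have eH: "e \<in> H" and l: "lev e = i" using e by (auto simp: Hs_def)
      have "block V (Suc i) ` e \<subseteq> {..<2 * 2 ^ i}"
        using block_less[OF fin, of _ "Suc i"] HV[OF eH] by auto
      moreover have "card (block V (Suc i) ` e) \<le> r"
        using card_image_le[OF finE[OF eH]] Hr[OF eH] by metis
      moreover have "(\<lambda>q. q div 2) ` block V (Suc i) ` e = block V i ` e"
        by (simp add: image_image block_Suc_div_2)
      ultimately show ?thesis
        using lev0[OF eH] lev1[OF eH] l assms(1) by (simp add: A_def hit_def)
    qed
    \<comment> \<open>Some classes \<open>Gs S\<close> may be empty. This is harmless, since only
      the number of sets in \<open>A\<close> is bounded.\<close>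
    then have U: "Hs i = \<Union>(Gs ` A)" by (auto simp: Gs_def)
    have "real (card (Gs ` A)) \<le> real (card A)" using card_image_le[OF finA] by simp
    also have "\<dots> \<le> real (2 ^ i) ^ (k - 1) / fact (k - 1)
        * (\<Sum>j=(k - 1) + 1..r. real ((2 * (k - 1)) choose j))"
      unfolding A_def by (rule card_subsets_few_halves)
    also have "\<dots> = 1 / fact (k - 1) * (\<Sum>j=k..r. real ((2 * k - 2) choose j)) * 2 ^ (i * (k - 1))"
    proof -
      have "(k - 1) + 1 = k" "2 * (k - 1) = 2 * k - 2" using assms(1) by simp_all
      then show ?thesis by (simp only: power_mult) simp
    qed
    finally have card: "real (card (Gs ` A)) \<le> \<dots>" .
    have "interval_partite_parts_le r k \<lceil>real n / 2 ^ i\<rceil> V (Gs S)" if S: "S \<in> A" for S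
    proof (rule interval_partite_block_image)
      show "ordered_rgraph r V (Gs S)" using assms(4) by (auto simp: ordered_rgraph_def Gs_def Hs_def)
      show "finite S" using S finite_subset by (auto simp: A_def)
      show "k \<le> card S" using S by (auto simp: A_def)
      \<comment> \<open>The parts are blocks of level \<open>Suc i\<close>, so their size bound is
        relaxed to that of level \<open>i\<close>.\<close>
      show "\<lceil>real (card V) / 2 ^ Suc i\<rceil> \<le> \<lceil>real n / 2 ^ i\<rceil>"
        unfolding assms(5) by (intro ceiling_mono) (simp add: field_simps)
    qed (simp add: Gs_def)
    then show ?thesis using U card finA by (intro exI[of _ "Gs ` A"]) auto
  qed
  ultimately show ?thesis unfolding L_def by blast
qed

end
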